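(* Let $n\geq 2$. There is a constant $C_n>0$ depending only on $n$ such that, for every finite set $L$ of lines in $\mathbb{R}^n$, the set $J$ of joints of $L$ satisfies $|J|\leq C_n|L|^{n/(n-1)}$.
   Context: For a set $L$ of lines in $\mathbb{R}^n$, a joint of $L$ is a point $x\in\mathbb{R}^n$ for which there exist lines $\ell_1,\dots,\ell_n\in L$, all passing through $x$, whose directions are linearly independent (so $\{x\}=\bigcap_{i=1}^n\ell_i$). The set of all joints of $L$ is denoted $J$. $|S|$ denotes the cardinality of a set $S$. *)

theory Defs
  imports "HOL-Analysis.Analysis"
begin

definition line_direction :: "(real ^ 'n) set \<Rightarrow> real ^ 'n \<Rightarrow> bool" where
  "line_direction l v \<longleftrightarrow> v \<noteq> 0 \<and> (\<exists>a. l = {a + t *\<^sub>R v | t. True})"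

definition is_line :: "(real ^ 'n) set \<Rightarrow> bool" where
  "is_line l \<longleftrightarrow> (\<exists>v. line_direction l v)"

(* The n lines and their directions are indexed by the coordinate type 'n, which has
   exactly n elements. Linear independence is that of a family: independence of the
   range alone would allow repeated vectors, hence the injectivity of v. *)
definition joints :: "(real ^ 'n) set set \<Rightarrow> (real ^ 'n) set" where
  "joints L = {x. \<exists>(l :: 'n \<Rightarrow> (real ^ 'n) set) (v :: 'n \<Rightarrow> real ^ 'n).
      (\<forall>i. l i \<in> L \<and> x \<in> l i \<and> line_direction (l i) (v i)) \<and>
      inj v \<and> independent (range v)}"

end

theory Submission
  imports Defs
begin

text \<open>
  The polynomial method. Among the nonzero polynomials vanishing on a finite nonempty set \<open>J\<close> of joints
  take one of least degree \<open>d\<close>; counting coefficients, \<open>d \<le> n * m\<close> whenever \<open>card J < (m + 1) ^ n\<close>. If each line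
  carried more than \<open>d\<close> points of \<open>J\<close>, the polynomial would vanish on all lines, so its gradient would
  vanish at each joint, and by minimality its partial derivatives would be zero: it would be a nonzero constant. So some
  line carries at most \<open>n * m\<close> points of \<open>J\<close>. Deleting lines one at a time yields
  \<open>card J \<le> n * m * card L\<close> with \<open>m ^ n \<le> card J\<close>.

  Polynomials are coefficient functions on exponent vectors, and ``nonzero'' refers to the coefficients.
  The partial derivatives are formal, which avoids the linear independence of monomials as functions.
\<close>

section \<open>Polynomials given by their coefficients\<close>

definition exponents :: "nat \<Rightarrow> ('n::finite \<Rightarrow> nat) set" where
  "exponents d = {a. (\<Sum>i\<in>UNIV. a i) \<le> d}"

definition monom_eval :: "('n::finite \<Rightarrow> nat) \<Rightarrow> real ^ 'n \<Rightarrow> real" where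
  "monom_eval a x = (\<Prod>i\<in>UNIV. x $ i ^ a i)"

text \<open>\<open>d\<close> only bounds the degree; coefficients outside \<open>exponents d\<close>
  are ignored and may be arbitrary.\<close>

definition mpoly_eval :: "nat \<Rightarrow> (('n::finite \<Rightarrow> nat) \<Rightarrow> real) \<Rightarrow> real ^ 'n \<Rightarrow> real" where
  "mpoly_eval d c x = (\<Sum>a\<in>exponents d. c a * monom_eval a x)"

definition mpoly_pderiv :: "'n \<Rightarrow> (('n::finite \<Rightarrow> nat) \<Rightarrow> real) \<Rightarrow> ('n \<Rightarrow> nat) \<Rightarrow> real" where
  "mpoly_pderiv i c a = real (Suc (a i)) * c (a(i := Suc (a i)))"

definition vanishing_mpoly :: "nat \<Rightarrow> (('n::finite \<Rightarrow> nat) \<Rightarrow> real) \<Rightarrow> (real ^ 'n) set \<Rightarrow> bool" where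
  "vanishing_mpoly d c J \<longleftrightarrow> (\<exists>a\<in>exponents d. c a \<noteq> 0) \<and> (\<forall>x\<in>J. mpoly_eval d c x = 0)"

lemma finite_exponents [simp]: "finite (exponents d :: ('n::finite \<Rightarrow> nat) set)"
proof (rule finite_subset)
  show "(exponents d :: ('n \<Rightarrow> nat) set) \<subseteq> Pi\<^sub>E UNIV (\<lambda>_. {..d})"
  proof
    fix a :: "'n \<Rightarrow> nat" assume a: "a \<in> exponents d"
    have "a i \<le> d" for i
      using member_le_sum[of i UNIV a] a by (auto simp: exponents_def)
    then show "a \<in> Pi\<^sub>E UNIV (\<lambda>_. {..d})" by (auto simp: PiE_def)
  qed
qed (auto intro!: finite_PiE)

section \<open>Vanishing polynomials by counting coefficients\<close>

lemma homogeneous_system_nontrivial_solution: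
  fixes f :: "'j \<Rightarrow> 'a \<Rightarrow> 'f::field"
  assumes "finite J" "finite A" "card J < card A"
  shows "\<exists>c. (\<exists>a\<in>A. c a \<noteq> 0) \<and> (\<forall>j\<in>J. (\<Sum>a\<in>A. c a * f j a) = 0)"
  using assms
proof (induction J arbitrary: A f rule: finite_induct)
  case empty
  then obtain a where "a \<in> A" by fastforce
  then show ?case by (intro exI[of _ "\<lambda>_. 1"]) auto
next
  case (insert j J)
  show ?case
  proof (cases "\<forall>a\<in>A. f j a = 0")
    case True
    have "card J < card A" using insert by simp
    with insert.IH[of A f] insert.prems True show ?thesis by auto
  next
    case False
    then obtain b where b: "b \<in> A" "f j b \<noteq> 0" by auto
    \<comment> \<open>Gaussian elimination: \<open>g\<close> is the system left after equation
      \<open>j\<close> is solved for the unknown \<open>b\<close>. The value of \<open>c'\<close> at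
      \<open>b\<close> is then the one that equation \<open>j\<close> forces.\<close>
    define g where "g k a = f k a - f k b * f j a / f j b" for k a
    have "card J < card (A - {b})" using insert b by simp
    then obtain c where c: "\<exists>a\<in>A - {b}. c a \<noteq> 0" "\<forall>k\<in>J. (\<Sum>a\<in>A - {b}. c a * g k a) = 0"
      using insert.IH[of "A - {b}" g] insert.prems by auto
    define s where "s = (\<Sum>a\<in>A - {b}. c a * f j a)"
    define c' where "c' = c(b := - s / f j b)"
    have split: "(\<Sum>a\<in>A. c' a * f k a) = - s / f j b * f k b + (\<Sum>a\<in>A - {b}. c a * f k a)" for k
    proof -
      have "(\<Sum>a\<in>A - {b}. c' a * f k a) = (\<Sum>a\<in>A - {b}. c a * f k a)"
        by (rule sum.cong) (auto simp: c'_def)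
      then show ?thesis
        using insert.prems b by (simp add: sum.remove[of A b] c'_def)
    qed
    have g_sum: "(\<Sum>a\<in>A - {b}. c a * g k a) = (\<Sum>a\<in>A - {b}. c a * f k a) - f k b / f j b * s" for k
      unfolding g_def s_def sum_distrib_left sum_subtractf[symmetric]
      by (rule sum.cong) (auto simp: algebra_simps)
    have "(\<Sum>a\<in>A. c' a * f j a) = 0"
      using b by (simp add: split s_def)
    moreover have "(\<Sum>a\<in>A. c' a * f k a) = 0" if "k \<in> J" for k
      using c(2) g_sum[of k] that by (simp add: split)
    moreover have "\<exists>a\<in>A. c' a \<noteq> 0" using c(1) by (auto simp: c'_def)
    ultimately show ?thesis by auto
  qed
qed

text \<open>The cube of exponents with every entry at most \<open>m\<close> lies in this set. This
  crude count avoids binomial coefficients and changes only the constant.\<close>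

lemma card_exponents_ge: "(m + 1) ^ CARD('n) \<le> card (exponents (CARD('n) * m) :: ('n::finite \<Rightarrow> nat) set)"
proof -
  have "Pi\<^sub>E UNIV (\<lambda>_. {..m}) \<subseteq> (exponents (CARD('n) * m) :: ('n \<Rightarrow> nat) set)"
  proof
    fix a :: "'n \<Rightarrow> nat" assume "a \<in> Pi\<^sub>E UNIV (\<lambda>_. {..m})"
    then have "(\<Sum>i\<in>UNIV. a i) \<le> of_nat CARD('n) * m" by (intro sum_bounded_above) auto
    then show "a \<in> exponents (CARD('n) * m)" by (simp add: exponents_def)
  qed
  then have "card (Pi\<^sub>E UNIV (\<lambda>_. {..m}) :: ('n \<Rightarrow> nat) set) \<le> card (exponents (CARD('n) * m) :: ('n \<Rightarrow> nat) set)"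
    by (intro card_mono) auto
  then show ?thesis by (simp add: card_PiE)
qed

lemma vanishing_mpoly_exists:
  fixes J :: "(real ^ 'n::finite) set"
  assumes "finite J" "card J < (m + 1) ^ CARD('n)"
  shows "\<exists>c. vanishing_mpoly (CARD('n) * m) c J"
proof -
  have "card J < card (exponents (CARD('n) * m) :: ('n \<Rightarrow> nat) set)"
    using assms(2) card_exponents_ge[where 'n = 'n, of m] by linarith
  from homogeneous_system_nontrivial_solution[OF assms(1) finite_exponents this, of "\<lambda>x a. monom_eval a x"]
  show ?thesis unfolding vanishing_mpoly_def mpoly_eval_def .
qed

section \<open>Restriction to a line, and the gradient\<close>

lemma mpoly_eval_along_line:
  fixes x v :: "real ^ 'n::finite"
  obtains p where "degree p \<le> d" "\<And>t. poly p t = mpoly_eval d c (x + t *\<^sub>R v)"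
proof
  let ?p = "\<Sum>a\<in>exponents d. smult (c a) (\<Prod>i\<in>UNIV. [:x $ i, v $ i:] ^ a i)"
  show "degree ?p \<le> d"
  proof (rule degree_sum_le)
    fix a :: "'n \<Rightarrow> nat" assume a: "a \<in> exponents d"
    have "degree (smult (c a) (\<Prod>i\<in>UNIV. [:x $ i, v $ i:] ^ a i))
        \<le> degree (\<Prod>i\<in>UNIV. [:x $ i, v $ i:] ^ a i)" by (rule degree_smult_le)
    also have "\<dots> \<le> (\<Sum>i\<in>UNIV. degree ([:x $ i, v $ i:] ^ a i))"
      using degree_prod_sum_le[of UNIV "\<lambda>i. [:x $ i, v $ i:] ^ a i"] by (simp add: o_def)
    also have "\<dots> \<le> (\<Sum>i\<in>UNIV. a i)"
    proof (rule sum_mono)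
      fix i
      have "degree ([:x $ i, v $ i:] ^ a i) \<le> degree [:x $ i, v $ i:] * a i" by (rule degree_power_le)
      also have "\<dots> \<le> a i" by simp
      finally show "degree ([:x $ i, v $ i:] ^ a i) \<le> a i" .
    qed
    also have "\<dots> \<le> d" using a by (simp add: exponents_def)
    finally show "degree (smult (c a) (\<Prod>i\<in>UNIV. [:x $ i, v $ i:] ^ a i)) \<le> d" .
  qed simp
  show "poly ?p t = mpoly_eval d c (x + t *\<^sub>R v)" for t
    by (simp add: mpoly_eval_def monom_eval_def poly_sum poly_prod)
qed

text \<open>The product rule. Where \<open>a i = 0\<close>, the truncated \<open>a i - 1\<close> is
  harmless because the factor \<open>real (a i)\<close> removes the term.\<close>

lemma monom_eval_has_derivative:
  fixes x v :: "real ^ 'n::finite"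
  shows "((\<lambda>t. monom_eval a (x + t *\<^sub>R v)) has_field_derivative
    (\<Sum>i\<in>UNIV. v $ i * (real (a i) * monom_eval (a(i := a i - 1)) x))) (at 0)"
proof -
  have *: "((\<lambda>t. (x $ i + t * v $ i) ^ a i) has_field_derivative
      real (a i) * (x $ i) ^ (a i - 1) * v $ i) (at 0)" for i
    by (auto intro!: derivative_eq_intros)
  have "((\<lambda>t. \<Prod>i\<in>UNIV. (x $ i + t * v $ i) ^ a i) has_field_derivative
      (\<Sum>i\<in>UNIV. real (a i) * (x $ i) ^ (a i - 1) * v $ i * (\<Prod>j\<in>UNIV - {i}. (x $ j + 0 * v $ j) ^ a j))) (at 0)"
    by (rule has_field_derivative_prod) (use * in auto)
  moreover have "monom_eval (a(i := a i - 1)) x = (x $ i) ^ (a i - 1) * (\<Prod>j\<in>UNIV - {i}. x $ j ^ a j)" for i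
  proof -
    have "(\<Prod>j\<in>UNIV - {i}. x $ j ^ (a(i := a i - 1)) j) = (\<Prod>j\<in>UNIV - {i}. x $ j ^ a j)"
      by (rule prod.cong) auto
    then show ?thesis
      unfolding monom_eval_def by (subst prod.remove[of _ i]) simp_all
  qed
  ultimately show ?thesis by (simp add: monom_eval_def mult_ac)
qed

lemma mpoly_eval_pderiv:
  fixes x :: "real ^ 'n::finite"
  shows "mpoly_eval d (mpoly_pderiv i c) x =
    (\<Sum>a\<in>exponents (Suc d). c a * (real (a i) * monom_eval (a(i := a i - 1)) x))"
proof -
  let ?up = "\<lambda>a :: 'n \<Rightarrow> nat. a(i := Suc (a i))"
  have sum_split: "(\<Sum>j\<in>UNIV. b j) = b i + (\<Sum>j\<in>UNIV - {i}. b j)" for b :: "'n \<Rightarrow> nat"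
    by (rule sum.remove) auto
  have sum_upd: "(\<Sum>j\<in>UNIV - {i}. (b(i := k)) j) = (\<Sum>j\<in>UNIV - {i}. b j)" for b :: "'n \<Rightarrow> nat" and k
    by (rule sum.cong) auto
  have "(\<Sum>a\<in>exponents (Suc d). c a * (real (a i) * monom_eval (a(i := a i - 1)) x)) =
      (\<Sum>a\<in>{a\<in>exponents (Suc d). a i > 0}. c a * (real (a i) * monom_eval (a(i := a i - 1)) x))"
    by (rule sum.mono_neutral_right) auto
  also have "\<dots> = (\<Sum>a\<in>exponents d. mpoly_pderiv i c a * monom_eval a x)"
    \<comment> \<open>Lowering coordinate \<open>i\<close> maps the exponents with
      \<open>a i > 0\<close> bijectively onto \<open>exponents d\<close>.\<close>
    by (rule sum.reindex_bij_witness[of _ ?up "\<lambda>a. a(i := a i - 1)"])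
      (auto simp: exponents_def mpoly_pderiv_def sum_split sum_upd fun_upd_idem)
  finally show ?thesis by (simp add: mpoly_eval_def)
qed

lemma mpoly_eval_has_derivative:
  fixes x v :: "real ^ 'n::finite"
  shows "((\<lambda>t. mpoly_eval (Suc d) c (x + t *\<^sub>R v)) has_field_derivative
    (\<chi> i. mpoly_eval d (mpoly_pderiv i c) x) \<bullet> v) (at 0)"
proof -
  have "((\<lambda>t. mpoly_eval (Suc d) c (x + t *\<^sub>R v)) has_field_derivative
    (\<Sum>a\<in>exponents (Suc d). c a * (\<Sum>i\<in>UNIV. v $ i * (real (a i) * monom_eval (a(i := a i - 1)) x)))) (at 0)"
    unfolding mpoly_eval_def by (intro DERIV_sum DERIV_cmult monom_eval_has_derivative)
  also have "(\<Sum>a\<in>exponents (Suc d). c a * (\<Sum>i\<in>UNIV. v $ i * (real (a i) * monom_eval (a(i := a i - 1)) x))) =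
      (\<chi> i. mpoly_eval d (mpoly_pderiv i c) x) \<bullet> v"
    unfolding inner_vec_def mpoly_eval_pderiv sum_distrib_left
    by (subst sum.swap) (simp add: sum_distrib_left sum_distrib_right mult_ac)
  finally show ?thesis .
qed

text \<open>Moves the base point to \<open>x\<close>, so that a joint sits at parameter 0, where the
  derivative is taken.\<close>

lemma line_through_point:
  assumes "line_direction l v" "x \<in> l"
  shows "l = range (\<lambda>t. x + t *\<^sub>R v)"
proof -
  obtain a where a: "l = {a + t *\<^sub>R v | t. True}" using assms(1) by (auto simp: line_direction_def)
  then obtain s where s: "x = a + s *\<^sub>R v" using assms(2) by auto
  have "a + t *\<^sub>R v = x + (t - s) *\<^sub>R v" "x + t *\<^sub>R v = a + (s + t) *\<^sub>R v" for t
    by (simp_all add: s algebra_simps)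
  then show ?thesis unfolding a by fastforce
qed

text \<open>On the line the polynomial has degree at most \<open>Suc d\<close> in \<open>t\<close>
  but more than \<open>Suc d\<close> roots, so it is zero, and with it its derivative at 0.\<close>

lemma derivative_vanishes_on_rich_line:
  fixes x v :: "real ^ 'n::finite"
  assumes l: "line_direction l v" "x \<in> l" and van: "\<forall>y\<in>J. mpoly_eval (Suc d) c y = 0"
    and rich: "finite J" "card (l \<inter> J) > Suc d"
  shows "(\<chi> i. mpoly_eval d (mpoly_pderiv i c) x) \<bullet> v = 0"
proof -
  obtain p where p: "degree p \<le> Suc d" "\<And>t. poly p t = mpoly_eval (Suc d) c (x + t *\<^sub>R v)"
    using mpoly_eval_along_line by blast
  have "p = 0"
  proof (rule ccontr)
    assume "p \<noteq> 0"
    have "l \<inter> J \<subseteq> (\<lambda>t. x + t *\<^sub>R v) ` {t. poly p t = 0}"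
      using line_through_point[OF l] van p(2) by auto
    then have "card (l \<inter> J) \<le> card {t. poly p t = 0}"
      by (rule surj_card_le[OF poly_roots_finite[OF \<open>p \<noteq> 0\<close>]])
    also have "\<dots> \<le> degree p" by (rule card_poly_roots_bound[OF \<open>p \<noteq> 0\<close>])
    finally show False using p(1) rich(2) by simp
  qed
  then have "(\<lambda>t. mpoly_eval (Suc d) c (x + t *\<^sub>R v)) = (\<lambda>t. 0)" using p(2) by (metis poly_0)
  with mpoly_eval_has_derivative[of d c x v] show ?thesis
    using DERIV_unique[OF _ DERIV_const] by metis
qed

text \<open>By injectivity there are n independent vectors, so they span the space and
  \<open>g\<close> is orthogonal to itself.\<close>

lemma orthogonal_to_basis_eq_0:
  fixes v :: "'n::finite \<Rightarrow> real ^ 'n"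
  assumes "inj v" "independent (range v)" "\<And>i. g \<bullet> v i = 0"
  shows "g = 0"
proof -
  have "card (range v) = DIM(real ^ 'n)" using assms(1) by (simp add: card_image)
  then have "span (range v) = UNIV"
    using card_ge_dim_independent[of "range v" UNIV] assms(2) by (auto simp: dim_UNIV)
  then have "orthogonal g g"
    using orthogonal_to_span[of g "range v" g] assms(3) by (auto simp: orthogonal_def)
  then show ?thesis by (simp add: orthogonal_def)
qed

text \<open>Some entry \<open>a i\<close> is positive, and the \<open>i\<close>-th derivative
  contains \<open>c a\<close> times this nonzero integer.\<close>

lemma pderiv_zero_imp_constant:
  fixes c :: "('n::finite \<Rightarrow> nat) \<Rightarrow> real"
  assumes "\<And>i a. a \<in> exponents d \<Longrightarrow> mpoly_pderiv i c a = 0"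
    and a: "a \<in> exponents (Suc d)" "a \<noteq> (\<lambda>_. 0)"
  shows "c a = 0"
proof -
  obtain i where i: "a i > 0" using a(2) by fastforce
  let ?b = "a(i := a i - 1)"
  have "(\<Sum>j\<in>UNIV - {i}. ?b j) = (\<Sum>j\<in>UNIV - {i}. a j)" by (rule sum.cong) auto
  then have "?b \<in> exponents d"
    using a(1) i by (simp add: exponents_def sum.remove[of UNIV i])
  from assms(1)[OF this, of i] i show ?thesis by (simp add: mpoly_pderiv_def)
qed

text \<open>At a point of \<open>J\<close> the value is the constant coefficient, so that
  coefficient is zero as well.\<close>

lemma constant_mpoly_not_vanishing:
  assumes "vanishing_mpoly d c J" "J \<noteq> {}" "\<And>a. a \<in> exponents d \<Longrightarrow> a \<noteq> (\<lambda>_. 0) \<Longrightarrow> c a = 0"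
  shows False
proof -
  obtain x where x: "x \<in> J" using assms(2) by auto
  have zero: "(\<lambda>_. 0) \<in> exponents d" by (simp add: exponents_def)
  have "mpoly_eval d c x = (\<Sum>a\<in>{\<lambda>_. 0}. c a * monom_eval a x)"
    unfolding mpoly_eval_def using zero assms(3) by (intro sum.mono_neutral_right) auto
  then have "c (\<lambda>_. 0) = 0" using assms(1) x by (simp add: vanishing_mpoly_def monom_eval_def)
  then show False using assms(1,3) unfolding vanishing_mpoly_def by metis
qed

section \<open>A line with few joints\<close>

lemma exists_line_with_few_joints:
  fixes L :: "(real ^ 'n::finite) set set"
  assumes J: "J \<subseteq> joints L" "finite J" "J \<noteq> {}" and m: "card J < (m + 1) ^ CARD('n)"
  shows "\<exists>l\<in>L. card (l \<inter> J) \<le> CARD('n) * m"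
proof (rule ccontr)
  assume "\<not> ?thesis"
  then have rich: "card (l \<inter> J) > CARD('n) * m" if "l \<in> L" for l using that by force
  define d where "d = (LEAST d. \<exists>c. vanishing_mpoly d c J)"
  have ex: "\<exists>c. vanishing_mpoly (CARD('n) * m) c J" by (rule vanishing_mpoly_exists[OF J(2) m])
  have "\<exists>c. vanishing_mpoly d c J"
    unfolding d_def using ex by (rule LeastI)
  then obtain c where c: "vanishing_mpoly d c J" ..
  have d_le: "d \<le> CARD('n) * m" unfolding d_def using ex by (rule Least_le)
  show False
  proof (cases d)
    case 0
    show False
      by (rule constant_mpoly_not_vanishing[OF c J(3)]) (auto simp: 0 exponents_def)
  next
    case (Suc k)
    have "mpoly_eval k (mpoly_pderiv i c) x = 0" if x: "x \<in> J" for x i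
    proof -
      obtain l :: "'n \<Rightarrow> (real ^ 'n) set" and v :: "'n \<Rightarrow> real ^ 'n" where lv: "\<And>i. l i \<in> L \<and> x \<in> l i \<and> line_direction (l i) (v i)"
        "inj v" "independent (range v)"
        using x J(1) unfolding joints_def by blast
      \<comment> \<open>The gradient is orthogonal to each of the n directions at the joint, since
        \<open>d \<le> CARD('n) * m\<close> makes every line rich enough.\<close>
      have "(\<chi> i. mpoly_eval k (mpoly_pderiv i c) x) \<bullet> v j = 0" for j
      proof (rule derivative_vanishes_on_rich_line[of "l j"])
        show "\<forall>y\<in>J. mpoly_eval (Suc k) c y = 0" using c by (simp add: vanishing_mpoly_def Suc)
        show "card (l j \<inter> J) > Suc k" using rich[of "l j"] lv(1) d_le Suc by force
      qed (use lv(1) J(2) in auto)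
      from orthogonal_to_basis_eq_0[OF lv(2,3) this] show ?thesis by (simp add: vec_eq_iff)
    qed
    \<comment> \<open>Minimality of \<open>d\<close>: each derivative vanishes on \<open>J\<close>
      with the smaller bound \<open>k\<close>, so its coefficients must all be zero.\<close>
    moreover have "\<not> vanishing_mpoly k c' J" for c'
      using not_less_Least[of k "\<lambda>d. \<exists>c. vanishing_mpoly d c J"] Suc unfolding d_def by auto
    ultimately have "mpoly_pderiv i c a = 0" if "a \<in> exponents k" for i a
      using that unfolding vanishing_mpoly_def by blast
    then show False
      using constant_mpoly_not_vanishing[OF c J(3)] pderiv_zero_imp_constant Suc by blast
  qed
qed

section \<open>Counting by deleting lines\<close>

lemma joints_remove_line: "joints L - l \<subseteq> joints (L - {l})"
  unfolding joints_def by fast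

text \<open>Each deleted line costs at most \<open>CARD('n) * m\<close> points, with
  \<open>m\<close> fixed throughout because \<open>J\<close> only shrinks. \<open>J\<close> is an
  arbitrary finite set of joints since points of \<open>l\<close> may remain joints of
  \<open>L - {l}\<close>.\<close>

lemma card_joints_le_mult:
  fixes L :: "(real ^ 'n::finite) set set"
  assumes "finite L" "J \<subseteq> joints L" "finite J" "card J < (m + 1) ^ CARD('n)"
  shows "card J \<le> CARD('n) * m * card L"
  using assms
proof (induction "card L" arbitrary: L J rule: less_induct)
  case less
  show ?case
  proof (cases "J = {}")
    case False
    with less.prems obtain l where l: "l \<in> L" "card (l \<inter> J) \<le> CARD('n) * m"
      using exists_line_with_few_joints by blast
    have card_L: "card L = Suc (card (L - {l}))"
      using less.prems(1) l(1) by (rule card.remove)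
    have "card (J - l) \<le> card J" using less.prems(3) by (intro card_mono) auto
    then have "card (J - l) \<le> CARD('n) * m * card (L - {l})"
      using less.prems joints_remove_line[of L l] card_L by (intro less.hyps) auto
    moreover have "card J = card (l \<inter> J) + card (J - l)"
      using card_Int_Diff[OF less.prems(3), of l] by (simp add: Int_commute)
    ultimately show ?thesis using l(2) by (simp add: card_L)
  qed simp
qed

text \<open>\<open>m\<close> is the integer part of the n-th root of \<open>k\<close>.\<close>

lemma exists_nat_root:
  assumes "n > 0"
  shows "\<exists>m::nat. m ^ n \<le> k \<and> k < (m + 1) ^ n"
proof -
  define m where "m = (LEAST m. k < (m + 1) ^ n)"
  have "k < (k + 1) ^ n" using assms self_le_power[of "k + 1" n] by simp
  then have less: "k < (m + 1) ^ n" unfolding m_def by (rule LeastI)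
  have "m ^ n \<le> k"
  proof (cases m)
    case (Suc j)
    then have "\<not> k < (j + 1) ^ n" using not_less_Least[of j "\<lambda>m. k < (m + 1) ^ n"] by (simp add: m_def)
    then show ?thesis by (simp add: Suc)
  qed (use assms in \<open>simp add: power_0_left\<close>)
  with less show ?thesis by blast
qed

text \<open>With k = |J|, the bounds k \<le> n m |L| and m \<le> k^(1/n) give k^(1 - 1/n) \<le> n
  |L|; raising to the power n/(n-1) finishes.\<close>

lemma card_joints_subset_le:
  fixes L :: "(real ^ 'n::finite) set set"
  assumes n: "CARD('n) \<ge> 2" and J: "finite L" "J \<subseteq> joints L" "finite J"
  shows "real (card J) \<le> (real CARD('n) * real (card L)) powr (real CARD('n) / (real CARD('n) - 1))"
proof (cases "J = {}")
  case False
  define k where "k = card J"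
  define n' where "n' = real CARD('n)"
  have k: "k > 0" using False J(3) by (simp add: k_def card_gt_0_iff)
  obtain m where m: "m ^ CARD('n) \<le> k" "k < (m + 1) ^ CARD('n)"
    using exists_nat_root[of "CARD('n)" k] by auto
  have "k \<le> CARD('n) * m * card L"
    using card_joints_le_mult[OF J] m(2) by (simp add: k_def)
  then have le: "real k \<le> n' * real m * real (card L)"
    unfolding n'_def by (simp flip: of_nat_mult)
  have "real m > 0" using le k by (cases m) auto
  have "n' \<ge> 2" using n by (simp add: n'_def)
  have "real m powr n' \<le> real k"
    using m(1) \<open>real m > 0\<close> by (simp add: n'_def powr_realpow flip: of_nat_power)
  then have "(real m powr n') powr (1 / n') \<le> real k powr (1 / n')"
    using \<open>n' \<ge> 2\<close> by (intro powr_mono2) auto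
  then have m_le: "real m \<le> real k powr (1 / n')"
    using \<open>n' \<ge> 2\<close> \<open>real m > 0\<close> by (simp add: powr_powr)
  have "real k powr (1 / n') * real k powr (1 - 1 / n') = real k"
    using k by (simp flip: powr_add)
  also have "\<dots> \<le> real m * (n' * real (card L))" using le by (simp add: mult_ac)
  also have "\<dots> \<le> real k powr (1 / n') * (n' * real (card L))"
    using m_le by (intro mult_right_mono) (auto simp: n'_def)
  finally have "real k powr (1 - 1 / n') \<le> n' * real (card L)"
    using k by simp
  then have "(real k powr (1 - 1 / n')) powr (n' / (n' - 1)) \<le> (n' * real (card L)) powr (n' / (n' - 1))"
    using \<open>n' \<ge> 2\<close> by (intro powr_mono2) auto
  moreover have "(1 - 1 / n') * (n' / (n' - 1)) = 1"
    using \<open>n' \<ge> 2\<close> by (simp add: field_simps)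
  ultimately show ?thesis using k unfolding k_def n'_def by (simp add: powr_powr)
qed simp

theorem theorem1:
  assumes "CARD('n::finite) \<ge> 2"
  shows "\<exists>C::real. C > 0 \<and>
    (\<forall>L :: (real ^ 'n) set set. finite L \<and> (\<forall>l\<in>L. is_line l) \<longrightarrow>
      finite (joints L) \<and>
      real (card (joints L)) \<le> C * real (card L) powr (real CARD('n) / (real CARD('n) - 1)))"
proof (intro exI conjI allI impI)
  let ?e = "real CARD('n) / (real CARD('n) - 1)"
  \<comment> \<open>This fixes the constant: the power of n that splits off the bound of
    \<open>card_joints_subset_le\<close>.\<close>
  show "real CARD('n) powr ?e > 0" by simp
  fix L :: "(real ^ 'n) set set"
  assume L: "finite L \<and> (\<forall>l\<in>L. is_line l)"
  have bound: "real (card J) \<le> (real CARD('n) * real (card L)) powr ?e"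
    if "J \<subseteq> joints L" "finite J" for J
    using card_joints_subset_le[OF assms] L that by blast
  show "finite (joints L)"
  \<comment> \<open>An infinite set has \<open>card\<close> 0, so finiteness needs its own argument:
    the finite subsets have uniformly bounded size.\<close>
  proof (rule conjunct1[OF finite_if_finite_subsets_card_bdd])
    show "card J \<le> nat \<lfloor>(real CARD('n) * real (card L)) powr ?e\<rfloor>"
      if "J \<subseteq> joints L" "finite J" for J
      using bound[OF that] by (rule le_nat_floor)
  qed
  then show "real (card (joints L)) \<le> real CARD('n) powr ?e * real (card L) powr ?e"
    using bound[of "joints L"] by (simp add: powr_mult)
qed

end
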